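(* Let $\lambda\in(0,\infty)$ and $a\in\mathbb{R}$. For every real $s$ for which both degenerate Laplace transforms below converge, we have $$\mathcal{L}_{\lambda}(\cosh_{\lambda}(at))=\frac{s-\lambda}{(s-\lambda)^2-a^2},\qquad \mathcal{L}_{\lambda}(\sinh_{\lambda}(at))=\frac{a}{(s-\lambda)^2-a^2}.$$
   Context: For $\lambda\in(0,\infty)$ and a function $f(t)$ defined for $t\ge 0$, the degenerate Laplace transform of $f$ is the function of $s$ given by $$\mathcal{L}_{\lambda}(f(t))=\int_0^{\infty}(1+\lambda t)^{-\frac{s}{\lambda}}f(t)\,dt=\lim_{b\to\infty}\int_0^{b}(1+\lambda t)^{-\frac{s}{\lambda}}f(t)\,dt,$$ provided the integral converges. The degenerate hyperbolic functions are defined by $$\cosh_{\lambda}(at)=\tfrac12\left((1+\lambda t)^{\frac a\lambda}+(1+\lambda t)^{-\frac a\lambda}\right),\qquad \sinh_{\lambda}(at)=\tfrac12\left((1+\lambda t)^{\frac a\lambda}-(1+\lambda t)^{-\frac a\lambda}\right).$$ (Here $\cosh_\lambda(at)$ and $\sinh_\lambda(at)$ are notation for these functions of $t$ with parameter $a$; $a$ appears only in the exponents, not multiplying $t$.) *)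

theory Defs
  imports "HOL-Analysis.Analysis"
begin

text \<open>
  The parameter of the degenerate calculus is written \<open>lam\<close>. For \<open>lam > 0\<close> and
  \<open>t \<ge> 0\<close> the base \<open>1 + lam * t\<close> is at least 1, so that \<open>powr\<close> is the ordinary real power.
\<close>

definition degenerate_laplace_partial ::
    "real \<Rightarrow> (real \<Rightarrow> real) \<Rightarrow> real \<Rightarrow> real \<Rightarrow> real" where
  "degenerate_laplace_partial lam f s b =
     integral {0..b} (\<lambda>t. (1 + lam * t) powr (- s / lam) * f t)"

text \<open>
  The first conjunct is needed because \<open>integral\<close> takes the value 0 on functions that are not
  integrable.
\<close>

definition degenerate_laplace_converges ::
    "real \<Rightarrow> (real \<Rightarrow> real) \<Rightarrow> real \<Rightarrow> bool" where
  "degenerate_laplace_converges lam f s \<longleftrightarrow>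
     (\<forall>b\<ge>0. (\<lambda>t. (1 + lam * t) powr (- s / lam) * f t) integrable_on {0..b}) \<and>
     (\<exists>L. (degenerate_laplace_partial lam f s \<longlongrightarrow> L) at_top)"

text \<open>The value of the transform is meaningful only where the transform converges.\<close>

definition degenerate_laplace :: "real \<Rightarrow> (real \<Rightarrow> real) \<Rightarrow> real \<Rightarrow> real" where
  "degenerate_laplace lam f s = Lim at_top (degenerate_laplace_partial lam f s)"

text \<open>
  In the notation \<open>cosh\<^sub>\<lambda>(at)\<close> and \<open>sinh\<^sub>\<lambda>(at)\<close> the product \<open>at\<close> is not an argument:
  \<open>a\<close> occurs only in the exponents, hence \<open>a\<close> and \<open>t\<close> are separate arguments here.
\<close>

definition degenerate_cosh :: "real \<Rightarrow> real \<Rightarrow> real \<Rightarrow> real" where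
  "degenerate_cosh lam a t =
     ((1 + lam * t) powr (a / lam) + (1 + lam * t) powr (- a / lam)) / 2"

definition degenerate_sinh :: "real \<Rightarrow> real \<Rightarrow> real \<Rightarrow> real" where
  "degenerate_sinh lam a t =
     ((1 + lam * t) powr (a / lam) - (1 + lam * t) powr (- a / lam)) / 2"

end

theory Submission
  imports Defs "HOL-Real_Asymp.Real_Asymp"
begin

text \<open>
  The sum and the difference of \<open>cosh\<^sub>\<lambda>(at)\<close> and \<open>sinh\<^sub>\<lambda>(at)\<close> are the degenerate exponentials
  \<open>(1 + \<lambda>t) powr (a / \<lambda>)\<close> and \<open>(1 + \<lambda>t) powr (- a / \<lambda>)\<close>. The transform of
  \<open>(1 + \<lambda>t) powr (c / \<lambda>)\<close> is the integral of a pure power of \<open>1 + \<lambda>t\<close>, which has an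
  elementary antiderivative; it converges only if \<open>c < s - \<lambda>\<close>, and then its value is
  \<open>1 / (s - \<lambda> - c)\<close>
  (\<open>degenerate_laplace_exp\<close>).

  The transform is linear where it converges, so convergence for \<open>cosh\<^sub>\<lambda>\<close> and \<open>sinh\<^sub>\<lambda>\<close> gives
  convergence for both exponentials. Hence \<open>\<bar>a\<bar> < s - \<lambda>\<close>, the denominators \<open>s - \<lambda> \<plusminus> a\<close> do not
  vanish, and the two unknown values \<open>C\<close> and \<open>S\<close> solve the linear system
  \<open>C + S = 1 / (s - \<lambda> - a)\<close>, \<open>C - S = 1 / (s - \<lambda> + a)\<close>.
\<close>

lemma degenerate_laplace_tendsto:
  assumes "degenerate_laplace_converges lam f s"
  shows "(degenerate_laplace_partial lam f s \<longlongrightarrow> degenerate_laplace lam f s) at_top"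
  using assms unfolding degenerate_laplace_converges_def degenerate_laplace_def
  by (metis tendsto_Lim trivial_limit_at_top_linorder)

lemma degenerate_laplace_eqI:
  assumes "(degenerate_laplace_partial lam f s \<longlongrightarrow> L) at_top"
  shows "degenerate_laplace lam f s = L"
  unfolding degenerate_laplace_def by (rule tendsto_Lim[OF _ assms]) simp

lemma
  assumes f: "degenerate_laplace_converges lam f s"
    and g: "degenerate_laplace_converges lam g s"
  shows degenerate_laplace_converges_add:
      "degenerate_laplace_converges lam (\<lambda>t. f t + g t) s"
    and degenerate_laplace_add:
      "degenerate_laplace lam (\<lambda>t. f t + g t) s
        = degenerate_laplace lam f s + degenerate_laplace lam g s"
proof -
  let ?w = "\<lambda>t. (1 + lam * t) powr (- s / lam)"
  have int: "(\<lambda>t. ?w t * f t) integrable_on {0..b}" "(\<lambda>t. ?w t * g t) integrable_on {0..b}"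
    if "b \<ge> 0" for b
    using f g that unfolding degenerate_laplace_converges_def by auto
  have "eventually (\<lambda>b. degenerate_laplace_partial lam f s b + degenerate_laplace_partial lam g s b
      = degenerate_laplace_partial lam (\<lambda>t. f t + g t) s b) at_top"
    using eventually_ge_at_top[of 0]
    by eventually_elim
      (simp only: degenerate_laplace_partial_def distrib_left integral_add[OF int])
  then have lim: "(degenerate_laplace_partial lam (\<lambda>t. f t + g t) s \<longlongrightarrow>
      degenerate_laplace lam f s + degenerate_laplace lam g s) at_top"
    using tendsto_add[OF degenerate_laplace_tendsto[OF f] degenerate_laplace_tendsto[OF g]]
    by (rule Lim_transform_eventually[rotated])
  then show "degenerate_laplace_converges lam (\<lambda>t. f t + g t) s"
    unfolding degenerate_laplace_converges_def
    using integrable_add[OF int] by (auto simp: distrib_left)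
  show "degenerate_laplace lam (\<lambda>t. f t + g t) s
      = degenerate_laplace lam f s + degenerate_laplace lam g s"
    by (rule degenerate_laplace_eqI[OF lim])
qed

lemma
  assumes f: "degenerate_laplace_converges lam f s"
  shows degenerate_laplace_converges_minus: "degenerate_laplace_converges lam (\<lambda>t. - f t) s"
    and degenerate_laplace_minus:
      "degenerate_laplace lam (\<lambda>t. - f t) s = - degenerate_laplace lam f s"
proof -
  have "degenerate_laplace_partial lam (\<lambda>t. - f t) s = (\<lambda>b. - degenerate_laplace_partial lam f s b)"
    by (simp add: degenerate_laplace_partial_def fun_eq_iff)
  then have lim: "(degenerate_laplace_partial lam (\<lambda>t. - f t) s \<longlongrightarrow> - degenerate_laplace lam f s) at_top"
    using tendsto_minus[OF degenerate_laplace_tendsto[OF f]] by simp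
  with f show "degenerate_laplace_converges lam (\<lambda>t. - f t) s"
    unfolding degenerate_laplace_converges_def using integrable_neg by fastforce
  show "degenerate_laplace lam (\<lambda>t. - f t) s = - degenerate_laplace lam f s"
    by (rule degenerate_laplace_eqI[OF lim])
qed

lemma has_integral_affine_powr:
  fixes lam p b :: real
  assumes "lam > 0" "b \<ge> 0" "p \<noteq> -1"
  shows "((\<lambda>t. (1 + lam * t) powr p) has_integral
           ((1 + lam * b) powr (p + 1) - 1) / (lam * (p + 1))) {0..b}"
proof -
  have "((\<lambda>t. (1 + lam * t) powr (p + 1) / (lam * (p + 1))) has_vector_derivative
      (1 + lam * t) powr p) (at t within {0..b})" if "t \<in> {0..b}" for t
  proof -
    have pos: "1 + lam * t > 0" using assms that by (simp add: add_pos_nonneg)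
    have "((\<lambda>t. 1 + lam * t) has_real_derivative lam) (at t)"
      by (auto intro!: derivative_eq_intros)
    from DERIV_cdivide[OF DERIV_fun_powr[OF this pos, of "p + 1"], of "lam * (p + 1)"]
    have "((\<lambda>t. (1 + lam * t) powr (p + 1) / (lam * (p + 1))) has_real_derivative
        (1 + lam * t) powr p * (lam * (p + 1)) / (lam * (p + 1))) (at t)"
      by (simp add: mult_ac)
    moreover have "lam * (p + 1) \<noteq> 0" using assms by (simp add: add_eq_0_iff2)
    ultimately show ?thesis
      unfolding has_real_derivative_iff_has_vector_derivative[symmetric]
      by (simp add: has_field_derivative_at_within)
  qed
  from fundamental_theorem_of_calculus[OF \<open>b \<ge> 0\<close> this] show ?thesis
    by (simp add: diff_divide_distrib)
qed

lemma has_integral_affine_inverse: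
  fixes lam b :: real
  assumes "lam > 0" "b \<ge> 0"
  shows "((\<lambda>t. (1 + lam * t) powr (-1)) has_integral ln (1 + lam * b) / lam) {0..b}"
proof -
  have "((\<lambda>t. ln (1 + lam * t) / lam) has_vector_derivative
      (1 + lam * t) powr (-1)) (at t within {0..b})" if "t \<in> {0..b}" for t
  proof -
    have "1 + lam * t > 0" using assms that by (simp add: add_pos_nonneg)
    then show ?thesis
      using assms unfolding has_real_derivative_iff_has_vector_derivative[symmetric]
      by (auto intro!: derivative_eq_intros simp: powr_minus divide_inverse)
  qed
  from fundamental_theorem_of_calculus[OF \<open>b \<ge> 0\<close> this] show ?thesis
    by simp
qed

text \<open>
  For \<open>p \<ge> -1\<close> the closed forms of the proper integrals (a logarithm for \<open>p = -1\<close>) are unbounded; for \<open>p < -1\<close> the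
  contribution of the upper end point vanishes in the limit. The value at \<open>p\<close> is therefore
  minus the antiderivative \<open>(1 + \<lambda>t) powr (p + 1) / (\<lambda> (p + 1))\<close> at \<open>t = 0\<close>.
\<close>

lemma affine_powr_improper_integral:
  fixes lam p L :: real
  assumes lam: "lam > 0"
    and L: "((\<lambda>b. integral {0..b} (\<lambda>t. (1 + lam * t) powr p)) \<longlongrightarrow> L) at_top"
  shows "p < -1" and "L = - 1 / (lam * (p + 1))"
proof -
  let ?F = "\<lambda>b. ((1 + lam * b) powr (p + 1) - 1) / (lam * (p + 1))"
  have F: "(?F \<longlongrightarrow> L) at_top" if "p \<noteq> -1"
    by (rule Lim_transform_eventually[OF L], rule eventually_mono[OF eventually_ge_at_top[of 0]])
      (use has_integral_affine_powr[OF lam _ that] in \<open>auto intro: integral_unique\<close>)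
  show "p < -1"
  proof (rule ccontr)
    assume "\<not> p < -1"
    then consider "p = -1" | "p + 1 > 0" by linarith
    then show False
    proof cases
      case 1
      have "((\<lambda>b. ln (1 + lam * b) / lam) \<longlongrightarrow> L) at_top"
        by (rule Lim_transform_eventually[OF L],
            rule eventually_mono[OF eventually_ge_at_top[of 0]])
          (use has_integral_affine_inverse[OF lam] 1 in \<open>auto intro: integral_unique\<close>)
      moreover have "filterlim (\<lambda>b. ln (1 + lam * b) / lam) at_top at_top"
        using lam by real_asymp
      ultimately show False
        using not_tendsto_and_filterlim_at_infinity filterlim_at_top_imp_at_infinity
          trivial_limit_at_top_linorder by blast
    next
      case 2
      have "filterlim (\<lambda>b. ((1 + lam * b) powr q - 1) / (lam * q)) at_top at_top"
        if "q > 0" for q :: real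
        using lam that by real_asymp
      from this[OF 2] F 2 show False
        using not_tendsto_and_filterlim_at_infinity filterlim_at_top_imp_at_infinity
          trivial_limit_at_top_linorder by fastforce
    qed
  qed
  have "((\<lambda>b. ((1 + lam * b) powr q - 1) / (lam * q)) \<longlongrightarrow> - 1 / (lam * q)) at_top"
    if "q < 0" for q :: real
  proof -
    have "((\<lambda>b. (1 + lam * b) powr q) \<longlongrightarrow> 0) at_top"
      using lam that by real_asymp
    from tendsto_divide[OF tendsto_diff[OF this tendsto_const[of 1]] tendsto_const[of "lam * q"]]
    show ?thesis using lam that by simp
  qed
  from this[of "p + 1"] F \<open>p < -1\<close> show "L = - 1 / (lam * (p + 1))"
    by (intro tendsto_unique[of at_top ?F]) auto
qed

lemma degenerate_laplace_exp:
  fixes lam c s :: real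
  assumes lam: "lam > 0"
    and conv: "degenerate_laplace_converges lam (\<lambda>t. (1 + lam * t) powr (c / lam)) s"
  shows "c < s - lam"
    and "degenerate_laplace lam (\<lambda>t. (1 + lam * t) powr (c / lam)) s = 1 / (s - lam - c)"
proof -
  let ?p = "(c - s) / lam"
  have "degenerate_laplace_partial lam (\<lambda>t. (1 + lam * t) powr (c / lam)) s
      = (\<lambda>b. integral {0..b} (\<lambda>t. (1 + lam * t) powr ?p))"
    by (simp add: degenerate_laplace_partial_def fun_eq_iff powr_add[symmetric]
        add_divide_distrib[symmetric] diff_divide_distrib)
  with degenerate_laplace_tendsto[OF conv]
  have lim: "((\<lambda>b. integral {0..b} (\<lambda>t. (1 + lam * t) powr ?p)) \<longlongrightarrow>
      degenerate_laplace lam (\<lambda>t. (1 + lam * t) powr (c / lam)) s) at_top"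
    by simp
  show less: "c < s - lam"
    using affine_powr_improper_integral(1)[OF lam lim] lam by (simp add: field_simps)
  have "lam * (?p + 1) = - (s - lam - c)"
    using lam by (simp add: field_simps)
  with affine_powr_improper_integral(2)[OF lam lim]
  show "degenerate_laplace lam (\<lambda>t. (1 + lam * t) powr (c / lam)) s = 1 / (s - lam - c)"
    by (simp only: minus_divide_divide)
qed

lemma partial_fractions:
  fixes x a :: real
  assumes "x - a \<noteq> 0" "x + a \<noteq> 0"
  shows "(1 / (x - a) + 1 / (x + a)) / 2 = x / ((x - a) * (x + a))"
    and "(1 / (x - a) - 1 / (x + a)) / 2 = a / ((x - a) * (x + a))"
  using assms by (simp_all add: add_frac_eq diff_frac_eq)

theorem theorem3p1:
  fixes lam a s :: real
  assumes "lam > 0"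
    and "degenerate_laplace_converges lam (degenerate_cosh lam a) s"
    and "degenerate_laplace_converges lam (degenerate_sinh lam a) s"
  shows "degenerate_laplace lam (degenerate_cosh lam a) s = (s - lam) / ((s - lam)\<^sup>2 - a\<^sup>2)
    \<and> degenerate_laplace lam (degenerate_sinh lam a) s = a / ((s - lam)\<^sup>2 - a\<^sup>2)"
proof -
  let ?C = "degenerate_laplace lam (degenerate_cosh lam a) s"
  let ?S = "degenerate_laplace lam (degenerate_sinh lam a) s"
  have plus: "(\<lambda>t. degenerate_cosh lam a t + degenerate_sinh lam a t)
      = (\<lambda>t. (1 + lam * t) powr (a / lam))"
    by (simp add: degenerate_cosh_def degenerate_sinh_def fun_eq_iff field_simps)
  have minus: "(\<lambda>t. degenerate_cosh lam a t + - degenerate_sinh lam a t)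
      = (\<lambda>t. (1 + lam * t) powr (- a / lam))"
    by (simp add: degenerate_cosh_def degenerate_sinh_def fun_eq_iff field_simps)
  note neg = degenerate_laplace_converges_minus[OF assms(3)]
  note exp_pos =
    degenerate_laplace_exp[OF assms(1) degenerate_laplace_converges_add[OF assms(2,3), unfolded plus]]
  note exp_neg =
    degenerate_laplace_exp[OF assms(1) degenerate_laplace_converges_add[OF assms(2) neg, unfolded minus]]
  have ne: "s - lam - a \<noteq> 0" "s - lam + a \<noteq> 0"
    using exp_pos(1) exp_neg(1) by auto
  have "?C + ?S = 1 / (s - lam - a)"
    using degenerate_laplace_add[OF assms(2,3)] exp_pos(2) by (simp add: plus)
  moreover have "?C - ?S = 1 / (s - lam + a)"
    using degenerate_laplace_add[OF assms(2) neg, unfolded minus]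
      degenerate_laplace_minus[OF assms(3)] exp_neg(2)
    by simp
  ultimately have "?C = (1 / (s - lam - a) + 1 / (s - lam + a)) / 2"
    and "?S = (1 / (s - lam - a) - 1 / (s - lam + a)) / 2"
    by auto
  moreover have "(s - lam)\<^sup>2 - a\<^sup>2 = (s - lam - a) * (s - lam + a)"
    by (simp add: power2_eq_square algebra_simps)
  ultimately show ?thesis
    using ne partial_fractions[of "s - lam" a] by simp
qed

end
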